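(* Let $G=(V_P\cup V_L,E)$ be a point-line graph and let $a_i\in\mathbb{S}^1$ for each $i\in V_L$. Then $G$ can be realised as a minimally infinitesimally fixed-line rigid point-line framework in $\mathbb{R}^2$ such that each $i\in V_L$ is realised as a line with normal $a_i$ if and only if $|E|=2|V_P|$ and $$|F|\le 2\nu_{V_P}(F)-3+\min\{3,2a(F)\}$$ for all nonempty $F\subseteq E$, where $a(F)=\dim\langle a_i:i\in V_L(F)\rangle$ and $V_L(F)$ is the set of vertices of $V_L$ incident to edges of $F$.
   Context: A point-line graph is a graph whose vertex set is partitioned into $V_P$ (points) and $V_L$ (lines); its edges split into $E_{PP},E_{PL},E_{LL}$ by endpoint types. $\nu_{V_P}(F)$ is the number of vertices of $V_P$ incident to edges of $F$. A point-line framework $(G,p,\ell)$ in $\mathbb{R}^2$ has $p:V_P\to\mathbb{R}^2$ and $\ell=(a,r):V_L\to\mathbb{S}^1\times\mathbb{R}$, line $j$ being $\{x:\langle x,a_j\rangle+r_j=0\}$ (so $a_j$ is its normal). It is infinitesimally fixed-line rigid if the linear system $\langle p_i-p_j,\dot p_i-\dot p_j\rangle=0$ ($ij\in E_{PP}$), $\langle\dot p_i,a_j\rangle=0$ ($ij\in E_{PL}$, $i\in V_P,j\in V_L$) in the unknowns $\dot p:V_P\to\mathbb{R}^2$ has only the zero solution. It is minimally infinitesimally fixed-line rigid if it is infinitesimally fixed-line rigid and deleting any edge of $G$ destroys this property. *)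

theory Defs
  imports "HOL-Analysis.Analysis"
begin

record 'v pl_graph =
  points :: "'v set"
  lines :: "'v set"
  edges :: "'v set set"

text \<open>Graphs are finite, simple and undirected: an edge is a set of two distinct vertices.\<close>

definition point_line_graph :: "'v pl_graph \<Rightarrow> bool" where
  "point_line_graph G \<longleftrightarrow>
     finite (points G) \<and> finite (lines G) \<and> points G \<inter> lines G = {} \<and>
     (\<forall>e \<in> edges G. e \<subseteq> points G \<union> lines G \<and> card e = 2)"

definition E_PP :: "'v pl_graph \<Rightarrow> 'v set set" where
  "E_PP G = {{i, j} | i j. i \<in> points G \<and> j \<in> points G \<and> {i, j} \<in> edges G}"

definition E_PL :: "'v pl_graph \<Rightarrow> 'v set set" where
  "E_PL G = {{i, j} | i j. i \<in> points G \<and> j \<in> lines G \<and> {i, j} \<in> edges G}"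

definition delete_edge :: "'v pl_graph \<Rightarrow> 'v set \<Rightarrow> 'v pl_graph" where
  "delete_edge G e = G\<lparr>edges := edges G - {e}\<rparr>"

definition points_of :: "'v pl_graph \<Rightarrow> 'v set set \<Rightarrow> 'v set" where
  "points_of G F = {v \<in> points G. \<exists>e \<in> F. v \<in> e}"

definition lines_of :: "'v pl_graph \<Rightarrow> 'v set set \<Rightarrow> 'v set" where
  "lines_of G F = {v \<in> lines G. \<exists>e \<in> F. v \<in> e}"

definition nu_P :: "'v pl_graph \<Rightarrow> 'v set set \<Rightarrow> nat" where
  "nu_P G F = card (points_of G F)"

definition normal_dim :: "'v pl_graph \<Rightarrow> ('v \<Rightarrow> real^2) \<Rightarrow> 'v set set \<Rightarrow> nat" where
  "normal_dim G a F = dim (span (a ` lines_of G F))"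

text \<open>
  A pair \<open>l j = (a, r)\<close> stands for the line \<open>{x. x \<bullet> a + r = 0}\<close> with unit normal \<open>a\<close>.
  Only the values of \<open>p\<close> on \<open>points G\<close> and of \<open>l\<close> on \<open>lines G\<close> are meaningful.
\<close>

definition point_line_framework ::
  "'v pl_graph \<Rightarrow> ('v \<Rightarrow> real^2) \<Rightarrow> ('v \<Rightarrow> (real^2) \<times> real) \<Rightarrow> bool" where
  "point_line_framework G p l \<longleftrightarrow>
     point_line_graph G \<and> (\<forall>j \<in> lines G. fst (l j) \<in> sphere 0 1)"

definition fixed_line_motion ::
  "'v pl_graph \<Rightarrow> ('v \<Rightarrow> real^2) \<Rightarrow> ('v \<Rightarrow> (real^2) \<times> real) \<Rightarrow> ('v \<Rightarrow> real^2) \<Rightarrow> bool" where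
  "fixed_line_motion G p l p' \<longleftrightarrow>
     (\<forall>i j. {i, j} \<in> E_PP G \<longrightarrow> (p i - p j) \<bullet> (p' i - p' j) = 0) \<and>
     (\<forall>i \<in> points G. \<forall>j \<in> lines G. {i, j} \<in> E_PL G \<longrightarrow> p' i \<bullet> fst (l j) = 0)"

definition inf_fixed_line_rigid ::
  "'v pl_graph \<Rightarrow> ('v \<Rightarrow> real^2) \<Rightarrow> ('v \<Rightarrow> (real^2) \<times> real) \<Rightarrow> bool" where
  "inf_fixed_line_rigid G p l \<longleftrightarrow>
     (\<forall>p'. fixed_line_motion G p l p' \<longrightarrow> (\<forall>i \<in> points G. p' i = 0))"

definition min_inf_fixed_line_rigid ::
  "'v pl_graph \<Rightarrow> ('v \<Rightarrow> real^2) \<Rightarrow> ('v \<Rightarrow> (real^2) \<times> real) \<Rightarrow> bool" where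
  "min_inf_fixed_line_rigid G p l \<longleftrightarrow>
     inf_fixed_line_rigid G p l \<and>
     (\<forall>e \<in> edges G. \<not> inf_fixed_line_rigid (delete_edge G e) p l)"

end

theory Submission
  imports Defs
begin

text \<open>
  A placement is minimally rigid iff the rigidity matrix is square with independent rows.
  Independent rows are orthogonal to the trivial motions (translations and rotation, or the
  translation along parallel lines), which gives the necessity of the count.

  For sufficiency, take a placement \<open>p\<close> such that all nearby placements have the same dependent
  edge sets, and suppose that the edges contain a circuit \<open>C\<close>, with relation \<open>\<Sum>e\<in>C. c e *\<^sub>R row p e = 0\<close>.
  Differentiating the relation along a perturbation of \<open>p\<close> and pairing with a motion \<open>y\<close> of \<open>C\<close> shows
  that \<open>c\<close> is also a relation between the linear parts of the rows at \<open>y\<close>. On a point-point edge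
  \<open>y i - y j\<close> is a multiple of \<open>p i - p j\<close> rotated by a right angle, so rotating back gives a second
  relation at \<open>p\<close>. As the relation of a circuit is unique up to scale, all these multiples
  are equal, and they vanish if \<open>C\<close> contains a point-line edge. Hence all motions of \<open>C\<close> are trivial,
  which forces more edges on \<open>C\<close> than the count allows.
\<close>

section \<open>Linear algebra of families of rows\<close>

text \<open>Gaussian elimination by induction on the equations: one equation with a nonzero
  coefficient removes one unknown from all the others.\<close>

lemma homogeneous_system_nontrivial:
  fixes M :: "'i \<Rightarrow> 'x \<Rightarrow> real"
  assumes "finite I" "finite X" "card I < card X"
  obtains y where "\<exists>x\<in>X. y x \<noteq> 0" "\<And>i. i \<in> I \<Longrightarrow> (\<Sum>x\<in>X. M i x * y x) = 0"
proof -
  have "\<exists>y. (\<exists>x\<in>X. y x \<noteq> 0) \<and> (\<forall>i\<in>I. (\<Sum>x\<in>X. M i x * y x) = 0)"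
    using assms
  proof (induction I arbitrary: X M rule: finite_induct)
    case empty
    then obtain x where "x \<in> X" by (metis card.empty card_gt_0_iff ex_in_conv)
    then show ?case by (intro exI[of _ "\<lambda>_. 1"]) auto
  next
    case (insert i I)
    show ?case
    proof (cases "\<forall>x\<in>X. M i x = 0")
      case True
      moreover have "card I < card X" using insert by simp
      ultimately show ?thesis using insert.IH[OF insert.prems(1), of M] by auto
    next
      case False
      then obtain x0 where x0: "x0 \<in> X" "M i x0 \<noteq> 0" by auto
      define X' where "X' = X - {x0}"
      have X: "X = insert x0 X'" "x0 \<notin> X'" "finite X'"
        using x0 insert.prems by (auto simp: X'_def)
      have "card I < card X'" using insert X by simp
      then obtain y where y: "\<exists>x\<in>X'. y x \<noteq> 0"
        "\<forall>j\<in>I. (\<Sum>x\<in>X'. (M j x - M j x0 * M i x / M i x0) * y x) = 0"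
        using insert.IH[of X' "\<lambda>j x. M j x - M j x0 * M i x / M i x0"] X by blast
      define s where "s = (\<Sum>x\<in>X'. M i x * y x)"
      \<comment> \<open>This value at the eliminated unknown \<open>x0\<close> makes equation
        \<open>i\<close> hold.\<close>
      define y' where "y' = y(x0 := - s / M i x0)"
      have split: "(\<Sum>x\<in>X. M j x * y' x) = - M j x0 * s / M i x0 + (\<Sum>x\<in>X'. M j x * y x)" for j
      proof -
        have "(\<Sum>x\<in>X'. M j x * y' x) = (\<Sum>x\<in>X'. M j x * y x)"
          using X by (intro sum.cong) (auto simp: y'_def)
        then show ?thesis using X by (simp add: y'_def)
      qed
      have "(\<Sum>x\<in>X. M i x * y' x) = 0" using x0 split[of i] s_def by simp
      moreover have "(\<Sum>x\<in>X. M j x * y' x) = 0" if "j \<in> I" for j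
      proof -
        have "0 = (\<Sum>x\<in>X'. M j x * y x - M j x0 / M i x0 * (M i x * y x))"
          using y(2) that by (simp add: left_diff_distrib mult.assoc)
        also have "\<dots> = (\<Sum>x\<in>X'. M j x * y x) - M j x0 / M i x0 * s"
          by (simp add: sum_subtractf sum_distrib_left s_def)
        finally show ?thesis using split[of j] by simp
      qed
      moreover have "\<exists>x\<in>X. y' x \<noteq> 0" using y(1) X by (auto simp: y'_def)
      ultimately show ?thesis by (intro exI[of _ y']) auto
    qed
  qed
  then show ?thesis using that by blast
qed

definition relation :: "'v set \<Rightarrow> ('i \<Rightarrow> 'v \<Rightarrow> 'b::real_vector) \<Rightarrow> 'i set \<Rightarrow> ('i \<Rightarrow> real) \<Rightarrow> bool"
  where "relation S R F c \<longleftrightarrow> (\<forall>v\<in>S. (\<Sum>e\<in>F. c e *\<^sub>R R e v) = 0)"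

text \<open>Rows form an indexed family, not a set, so two edges with equal rows are
  dependent.\<close>

definition row_dependent :: "'v set \<Rightarrow> ('i \<Rightarrow> 'v \<Rightarrow> 'b::real_vector) \<Rightarrow> 'i set \<Rightarrow> bool"
  where "row_dependent S R F \<longleftrightarrow> (\<exists>c. relation S R F c \<and> (\<exists>e\<in>F. c e \<noteq> 0))"

definition pairing :: "'v set \<Rightarrow> ('v \<Rightarrow> 'b::real_inner) \<Rightarrow> ('v \<Rightarrow> 'b) \<Rightarrow> real"
  where "pairing S f g = (\<Sum>v\<in>S. f v \<bullet> g v)"

lemma pairing_relation:
  assumes "relation S R F c"
  shows "(\<Sum>e\<in>F. c e * pairing S (R e) y) = 0"
proof -
  have "(\<Sum>e\<in>F. c e * pairing S (R e) y) = (\<Sum>v\<in>S. (\<Sum>e\<in>F. c e *\<^sub>R R e v) \<bullet> y v)"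
    unfolding pairing_def sum_distrib_left inner_sum_left
    by (subst sum.swap) simp
  then show ?thesis using assms by (simp add: relation_def)
qed

lemma pairing_mono_neutral:
  assumes "finite S" "T \<subseteq> S" "\<And>v. v \<in> S - T \<Longrightarrow> f v \<bullet> g v = 0"
  shows "pairing S f g = pairing T f g"
  unfolding pairing_def using assms by (intro sum.mono_neutral_right) auto

text \<open>Each vertex of \<open>S\<close> contributes one unknown per basis vector, so the
  functionals are too few to determine \<open>y\<close>. Extending \<open>y\<close> by zero lets
  pairings over a larger vertex set be computed on \<open>S\<close>.\<close>

lemma exists_common_kernel:
  fixes \<Phi> :: "('v \<Rightarrow> 'b::euclidean_space) set"
  assumes "finite \<Phi>" "finite S" "card \<Phi> < DIM('b) * card S"
  obtains y where "\<exists>v\<in>S. y v \<noteq> 0" "\<And>v. v \<notin> S \<Longrightarrow> y v = 0" "\<And>f. f \<in> \<Phi> \<Longrightarrow> pairing S f y = 0"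
proof -
  have "card \<Phi> < card (S \<times> (Basis::'b set))"
    using assms by (simp add: card_cartesian_product mult.commute)
  then obtain z where z: "\<exists>x\<in>S \<times> (Basis::'b set). z x \<noteq> 0"
    "\<And>f. f \<in> \<Phi> \<Longrightarrow> (\<Sum>x\<in>S \<times> Basis. (f (fst x) \<bullet> snd x) * z x) = 0"
    using homogeneous_system_nontrivial[of \<Phi> "S \<times> (Basis::'b set)" "\<lambda>f x. f (fst x) \<bullet> snd x"]
      assms by auto
  define y where "y v = (if v \<in> S then \<Sum>b\<in>Basis. z (v, b) *\<^sub>R b else 0)" for v
  have "pairing S f y = 0" if "f \<in> \<Phi>" for f
  proof -
    have "pairing S f y = (\<Sum>v\<in>S. \<Sum>b\<in>Basis. (f v \<bullet> b) * z (v, b))"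
      by (simp add: pairing_def y_def inner_sum_right mult.commute)
    also have "\<dots> = (\<Sum>x\<in>S \<times> Basis. (f (fst x) \<bullet> snd x) * z x)"
      by (simp add: sum.cartesian_product case_prod_unfold)
    finally show ?thesis using z(2) that by simp
  qed
  moreover obtain v b where vb: "v \<in> S" "b \<in> Basis" "z (v, b) \<noteq> 0" using z(1) by auto
  then have "y v \<bullet> b \<noteq> 0"
    by (simp add: y_def inner_sum_left inner_Basis if_distrib cong: if_cong)
  then have "\<exists>v\<in>S. y v \<noteq> 0" using vb(1) inner_zero_left by metis
  ultimately show ?thesis using that[of y] by (simp add: y_def)
qed

lemma relation_iff_coordinates:
  fixes R :: "'i \<Rightarrow> 'v \<Rightarrow> 'b::euclidean_space"
  shows "relation S R F c \<longleftrightarrow>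
    (\<forall>x\<in>S \<times> Basis. (\<Sum>e\<in>F. (R e (fst x) \<bullet> snd x) * c e) = 0)"
  by (auto simp: relation_def euclidean_eq_iff[of _ "0::'b"] inner_sum_left mult.commute)

text \<open>This is the transposed system: the unknowns are the coefficients of the rows, the
  equations are the coordinates at the vertices of \<open>S\<close>.\<close>

lemma row_dependent_if_many:
  fixes R :: "'i \<Rightarrow> 'v \<Rightarrow> 'b::euclidean_space"
  assumes "finite F" "finite S" "card F > DIM('b) * card S"
  shows "row_dependent S R F"
proof -
  have "card (S \<times> (Basis::'b set)) < card F"
    using assms by (simp add: card_cartesian_product mult.commute)
  then obtain c where "\<exists>e\<in>F. c e \<noteq> 0"
    "\<And>x. x \<in> S \<times> Basis \<Longrightarrow> (\<Sum>e\<in>F. (R e (fst x) \<bullet> snd x) * c e) = 0"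
    using homogeneous_system_nontrivial[of "S \<times> (Basis::'b set)" F "\<lambda>x e. R e (fst x) \<bullet> snd x"]
      assms by auto
  then show ?thesis unfolding row_dependent_def relation_iff_coordinates by blast
qed

text \<open>Two mutually orthogonal independent families are jointly independent. With motions as
  \<open>Y\<close> this bounds the number of independent rows.\<close>

lemma card_add_orthogonal_le:
  fixes R :: "'i \<Rightarrow> 'v \<Rightarrow> 'b::euclidean_space" and Y :: "'j \<Rightarrow> 'v \<Rightarrow> 'b"
  assumes fin: "finite F" "finite J" "finite S"
    and R: "\<not> row_dependent S R F" and Y: "\<not> row_dependent S Y J"
    and orth: "\<And>e j. e \<in> F \<Longrightarrow> j \<in> J \<Longrightarrow> pairing S (R e) (Y j) = 0"
  shows "card F + card J \<le> DIM('b) * card S"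
proof (rule ccontr)
  assume "\<not> ?thesis"
  then have "card (F <+> J) > DIM('b) * card S" using fin by (simp add: card_Plus)
  then have "row_dependent S (case_sum R Y) (F <+> J)"
    using fin by (intro row_dependent_if_many) auto
  then obtain c where c: "relation S (case_sum R Y) (F <+> J) c" "\<exists>x\<in>F <+> J. c x \<noteq> 0"
    by (auto simp: row_dependent_def)
  \<comment> \<open>\<open>Z\<close> is orthogonal to all rows \<open>R e\<close> and is minus a
    combination of them. Hence it vanishes on \<open>S\<close>, and both halves of the relation are
    relations of their own.\<close>
  define Z where "Z v = (\<Sum>j\<in>J. c (Inr j) *\<^sub>R Y j v)" for v
  have sumc: "(\<Sum>e\<in>F. c (Inl e) *\<^sub>R R e v) + Z v = 0" if "v \<in> S" for v
    using c(1) that fin by (simp add: relation_def sum.Plus Z_def)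
  have pz: "pairing S (R e) Z = 0" if "e \<in> F" for e
  proof -
    have "pairing S (R e) Z = (\<Sum>j\<in>J. c (Inr j) * pairing S (R e) (Y j))"
      unfolding pairing_def Z_def inner_sum_right sum_distrib_left by (subst sum.swap) simp
    then show ?thesis using orth that by simp
  qed
  have "(\<Sum>v\<in>S. Z v \<bullet> Z v) = - (\<Sum>v\<in>S. (\<Sum>e\<in>F. c (Inl e) *\<^sub>R R e v) \<bullet> Z v)"
    unfolding sum_negf[symmetric]
    by (intro sum.cong) (use sumc in \<open>auto simp: eq_neg_iff_add_eq_0 inner_add_left[symmetric] add.commute\<close>)
  also have "(\<Sum>v\<in>S. (\<Sum>e\<in>F. c (Inl e) *\<^sub>R R e v) \<bullet> Z v) = (\<Sum>e\<in>F. c (Inl e) * pairing S (R e) Z)"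
    unfolding pairing_def inner_sum_left sum_distrib_left by (subst sum.swap) simp
  finally have "(\<Sum>v\<in>S. Z v \<bullet> Z v) = 0" using pz by simp
  then have Z0: "Z v = 0" if "v \<in> S" for v
    using that fin by (simp add: sum_nonneg_eq_0_iff)
  then have "relation S Y J (\<lambda>j. c (Inr j))" by (simp add: relation_def Z_def)
  then have J0: "c (Inr j) = 0" if "j \<in> J" for j using Y that by (auto simp: row_dependent_def)
  have "relation S R F (\<lambda>e. c (Inl e))" using sumc Z0 by (simp add: relation_def)
  then have "c (Inl e) = 0" if "e \<in> F" for e using R that by (auto simp: row_dependent_def)
  then show False using c(2) J0 by auto
qed

text \<open>A nonzero \<open>y\<close> would be an independent family of size one orthogonal to all
  rows, one vector more than the dimension permits.\<close>

lemma kernel_trivial_if_square_independent: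
  fixes R :: "'i \<Rightarrow> 'v \<Rightarrow> 'b::euclidean_space"
  assumes fin: "finite F" "finite S" and card: "card F = DIM('b) * card S"
    and R: "\<not> row_dependent S R F" and y: "\<And>e. e \<in> F \<Longrightarrow> pairing S (R e) y = 0"
    and v: "v \<in> S"
  shows "y v = 0"
proof (rule ccontr)
  assume "y v \<noteq> 0"
  then have "\<not> row_dependent S (\<lambda>_::unit. y) {()}"
    using v by (auto simp: row_dependent_def relation_def)
  then have "card F + card {()} \<le> DIM('b) * card S"
    using assms by (intro card_add_orthogonal_le) auto
  then show False using card by simp
qed

lemma row_independent_subset:
  assumes "\<not> row_dependent S R F" "F' \<subseteq> F" "finite F"
  shows "\<not> row_dependent S R F'"
proof
  assume "row_dependent S R F'"
  then obtain c where c: "relation S R F' c" "\<exists>e\<in>F'. c e \<noteq> 0" by (auto simp: row_dependent_def)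
  define c' where "c' e = (if e \<in> F' then c e else 0)" for e
  have "(\<Sum>e\<in>F. c' e *\<^sub>R R e v) = (\<Sum>e\<in>F'. c e *\<^sub>R R e v)" for v
    using assms by (intro sum.mono_neutral_cong_right) (auto simp: c'_def)
  then have "relation S R F c'" using c by (simp add: relation_def)
  moreover have "\<exists>e\<in>F. c' e \<noteq> 0" using c assms by (auto simp: c'_def)
  ultimately show False using assms by (auto simp: row_dependent_def)
qed

lemma row_independent_restrict:
  assumes "\<not> row_dependent S R F" "T \<subseteq> S" "\<And>e v. e \<in> F \<Longrightarrow> v \<in> S - T \<Longrightarrow> R e v = 0"
  shows "\<not> row_dependent T R F"
proof
  assume "row_dependent T R F"
  then obtain c where c: "relation T R F c" "\<exists>e\<in>F. c e \<noteq> 0" by (auto simp: row_dependent_def)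
  have "relation S R F c" unfolding relation_def
  proof
    fix v assume "v \<in> S"
    show "(\<Sum>e\<in>F. c e *\<^sub>R R e v) = 0"
    proof (cases "v \<in> T")
      case False then show ?thesis using assms(3) \<open>v \<in> S\<close> by simp
    qed (use c in \<open>auto simp: relation_def\<close>)
  qed
  then show False using c assms by (auto simp: row_dependent_def)
qed

text \<open>Subtracting from \<open>d\<close> the multiple of \<open>c\<close> that agrees with it
  at \<open>e0\<close> leaves a relation on \<open>C - {e0}\<close>, which is trivial.\<close>

lemma circuit_relation_unique:
  assumes fin: "finite C"
    and circ: "\<And>D. D \<subset> C \<Longrightarrow> \<not> row_dependent S R D"
    and c: "relation S R C c" "\<exists>e\<in>C. c e \<noteq> 0" and d: "relation S R C d"
  obtains s where "\<And>e. e \<in> C \<Longrightarrow> d e = s * c e"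
proof -
  obtain e0 where e0: "e0 \<in> C" "c e0 \<noteq> 0" using c by auto
  define s where "s = d e0 / c e0"
  have "relation S R (C - {e0}) (\<lambda>e. d e - s * c e)"
    unfolding relation_def
  proof
    fix v assume "v \<in> S"
    have "(\<Sum>e\<in>C. (d e - s * c e) *\<^sub>R R e v) = (\<Sum>e\<in>C. d e *\<^sub>R R e v) - s *\<^sub>R (\<Sum>e\<in>C. c e *\<^sub>R R e v)"
      by (simp add: scaleR_left_diff_distrib sum_subtractf scaleR_sum_right)
    also have "\<dots> = 0" using c d \<open>v \<in> S\<close> by (simp add: relation_def)
    finally show "(\<Sum>e\<in>C - {e0}. (d e - s * c e) *\<^sub>R R e v) = 0"
      using fin e0 by (simp add: sum_diff1 s_def)
  qed
  moreover have "\<not> row_dependent S R (C - {e0})" using circ e0 by blast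
  ultimately have "\<forall>e\<in>C - {e0}. d e - s * c e = 0"
    unfolding row_dependent_def by blast
  then have "d e = s * c e" if "e \<in> C" for e
    using that e0 by (cases "e = e0") (auto simp: s_def)
  then show ?thesis using that by blast
qed

text \<open>A vanishing coefficient would leave a nontrivial relation on a proper subset.\<close>

lemma circuit_relation_nonzero:
  assumes fin: "finite C"
    and circ: "\<And>D. D \<subset> C \<Longrightarrow> \<not> row_dependent S R D"
    and c: "relation S R C c" "\<exists>e\<in>C. c e \<noteq> 0" and e: "e \<in> C"
  shows "c e \<noteq> 0"
proof
  assume "c e = 0"
  then have "relation S R (C - {e}) c" using c fin e by (simp add: relation_def sum_diff1)
  moreover have "\<exists>f\<in>C - {e}. c f \<noteq> 0" using c \<open>c e = 0\<close> by auto
  ultimately show False using circ[of "C - {e}"] e by (auto simp: row_dependent_def)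
qed

section \<open>Limits of relations\<close>

text \<open>Bolzano-Weierstrass, one index at a time, passing to a further subsequence at each
  step.\<close>

lemma bounded_family_convergent_subseq:
  fixes c :: "nat \<Rightarrow> 'i \<Rightarrow> real"
  assumes "finite F" "\<And>n e. e \<in> F \<Longrightarrow> \<bar>c n e\<bar> \<le> B"
  obtains r d where "strict_mono (r :: nat \<Rightarrow> nat)" "\<And>e. e \<in> F \<Longrightarrow> (\<lambda>n. c (r n) e) \<longlonglongrightarrow> d e"
proof -
  have "\<exists>(r::nat\<Rightarrow>nat) d. strict_mono r \<and> (\<forall>e\<in>F. (\<lambda>n. c (r n) e) \<longlonglongrightarrow> d e)"
    using assms
  proof (induction F rule: finite_induct)
    case empty
    show ?case by (intro exI[of _ "\<lambda>n. n"]) (simp add: strict_mono_def)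
  next
    case (insert x F)
    then obtain r d where r: "strict_mono (r :: nat \<Rightarrow> nat)" "\<forall>e\<in>F. (\<lambda>n. c (r n) e) \<longlonglongrightarrow> d e"
      by auto
    have "bounded (range (\<lambda>n. c (r n) x))"
      using insert.prems by (intro boundedI[of _ B]) auto
    then obtain l q where q: "strict_mono q" "((\<lambda>n. c (r n) x) \<circ> q) \<longlonglongrightarrow> l"
      using bounded_imp_convergent_subsequence by blast
    have "(\<lambda>n. c (r (q n)) e) \<longlonglongrightarrow> (d(x := l)) e" if "e \<in> insert x F" for e
      using q r that insert.hyps LIMSEQ_subseq_LIMSEQ[OF _ q(1), of "\<lambda>n. c (r n) e"]
      by (auto simp: o_def)
    moreover have "strict_mono (\<lambda>n. r (q n))" using r q by (simp add: strict_mono_def)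
    ultimately show ?case by (intro exI[of _ "\<lambda>n. r (q n)"] exI[of _ "d(x := l)"]) (auto simp del: fun_upd_apply)
  qed
  then show ?thesis using that by blast
qed

text \<open>The normalisation bounds the coefficients and keeps their limits from all being
  zero.\<close>

lemma row_dependent_normalized:
  assumes "row_dependent S R F" "finite F"
  obtains c where "relation S R F c" "(\<Sum>e\<in>F. \<bar>c e\<bar>) = 1"
proof -
  obtain c where c: "relation S R F c" "\<exists>e\<in>F. c e \<noteq> 0" using assms by (auto simp: row_dependent_def)
  define s where "s = (\<Sum>e\<in>F. \<bar>c e\<bar>)"
  have "s > 0" using c assms by (auto simp: s_def intro!: sum_pos2)
  have "(\<Sum>e\<in>F. (c e / s) *\<^sub>R R e v) = (1 / s) *\<^sub>R (\<Sum>e\<in>F. c e *\<^sub>R R e v)" for v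
    by (simp add: scaleR_sum_right)
  then have "relation S R F (\<lambda>e. c e / s)" using c by (simp add: relation_def)
  moreover have "(\<Sum>e\<in>F. \<bar>c e / s\<bar>) = 1"
    using \<open>s > 0\<close> by (simp add: sum_divide_distrib[symmetric] s_def[symmetric])
  ultimately show ?thesis using that by blast
qed

text \<open>Normalised coefficients range over a compact set. The approximating relations are part
  of the conclusion because their pairings with a motion are later passed to the limit.\<close>

lemma row_dependent_limit:
  fixes R :: "nat \<Rightarrow> 'i \<Rightarrow> 'v \<Rightarrow> 'b::real_normed_vector"
  assumes "finite F" "\<And>n. row_dependent S (R n) F"
    and lim: "\<And>e v. e \<in> F \<Longrightarrow> v \<in> S \<Longrightarrow> (\<lambda>n. R n e v) \<longlonglongrightarrow> R' e v"
  obtains r c d where "strict_mono (r :: nat \<Rightarrow> nat)" "\<And>n. relation S (R n) F (c n)"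
    "\<And>e. e \<in> F \<Longrightarrow> (\<lambda>n. c (r n) e) \<longlonglongrightarrow> d e" "relation S R' F d" "\<exists>e\<in>F. d e \<noteq> 0"
proof -
  have "\<exists>c. relation S (R n) F c \<and> (\<Sum>e\<in>F. \<bar>c e\<bar>) = 1" for n
    using assms row_dependent_normalized by metis
  then obtain c where c: "\<And>n. relation S (R n) F (c n)" "\<And>n. (\<Sum>e\<in>F. \<bar>c n e\<bar>) = 1"
    by metis
  have "\<bar>c n e\<bar> \<le> 1" if "e \<in> F" for n e
    using member_le_sum[of e F "\<lambda>e. \<bar>c n e\<bar>"] c(2)[of n] that assms by simp
  then obtain r d where r: "strict_mono (r :: nat \<Rightarrow> nat)" "\<And>e. e \<in> F \<Longrightarrow> (\<lambda>n. c (r n) e) \<longlonglongrightarrow> d e"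
    using bounded_family_convergent_subseq[of F c 1] assms by metis
  have "(\<lambda>n. \<Sum>e\<in>F. \<bar>c (r n) e\<bar>) \<longlonglongrightarrow> (\<Sum>e\<in>F. \<bar>d e\<bar>)"
    using r by (intro tendsto_intros) auto
  then have "(\<Sum>e\<in>F. \<bar>d e\<bar>) = 1" using c(2) by (simp add: LIMSEQ_const_iff)
  then have "\<exists>e\<in>F. d e \<noteq> 0" by (metis abs_zero sum.neutral zero_neq_one)
  moreover have "(\<Sum>e\<in>F. d e *\<^sub>R R' e v) = 0" if "v \<in> S" for v
  proof -
    have "(\<lambda>n. \<Sum>e\<in>F. c (r n) e *\<^sub>R R (r n) e v) \<longlonglongrightarrow> (\<Sum>e\<in>F. d e *\<^sub>R R' e v)"
      using r lim[OF _ that] LIMSEQ_subseq_LIMSEQ[OF lim[OF _ that] r(1)]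
      by (intro tendsto_intros) (auto simp: o_def)
    moreover have "(\<Sum>e\<in>F. c (r n) e *\<^sub>R R (r n) e v) = 0" for n
      using c(1) that by (simp add: relation_def)
    ultimately show ?thesis by (simp add: LIMSEQ_const_iff)
  qed
  ultimately show ?thesis using that[of r c d] r c(1) by (auto simp: relation_def)
qed

section \<open>Rotation by a right angle in the plane\<close>

definition rot :: "real^2 \<Rightarrow> real^2"
  where "rot x = vector [- x$2, x$1]"

lemma rot_component [simp]: "rot x $ 1 = - x$2" "rot x $ 2 = x$1"
  by (simp_all add: rot_def)

lemma inner_real2: "(x::real^2) \<bullet> y = x$1 * y$1 + x$2 * y$2"
  by (simp add: inner_vec_def sum_2)

lemma vec2_eq_iff: "x = (y::real^2) \<longleftrightarrow> x$1 = y$1 \<and> x$2 = y$2"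
  by (simp add: vec_eq_iff forall_2)

lemma rot_linear: "rot (x + y) = rot x + rot y" "rot (x - y) = rot x - rot y" "rot (s *\<^sub>R x) = s *\<^sub>R rot x" "rot 0 = 0"
  by (simp_all add: vec2_eq_iff)

lemma rot_eq_0_iff [simp]: "rot x = 0 \<longleftrightarrow> x = 0"
  by (auto simp: vec2_eq_iff)

lemma rot_sum: "rot (\<Sum>e\<in>F. f e) = (\<Sum>e\<in>F. rot (f e))"
  by (simp add: vec2_eq_iff sum_negf)

lemma inner_rot_self [simp]: "x \<bullet> rot x = 0" "rot x \<bullet> x = 0"
  by (simp_all add: inner_real2)

text \<open>The orthogonal complement of a nonzero vector in the plane is a line, spanned by its
  rotation.\<close>

lemma orthogonal_eq_rot:
  assumes "x \<bullet> y = 0" "x \<noteq> 0"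
  obtains s where "y = s *\<^sub>R rot x"
proof -
  have n: "x$1 * x$1 + x$2 * x$2 \<noteq> 0"
    using assms(2) by (simp add: vec2_eq_iff sum_squares_eq_zero_iff)
  \<comment> \<open>This is the projection to \<open>rot x\<close>, which has the same length as
    \<open>x\<close>.\<close>
  have "y = ((rot x \<bullet> y) / (x \<bullet> x)) *\<^sub>R rot x"
  proof -
    have "(x$1 * x$1 + x$2 * x$2) * y$1 = (x$1 * y$2 - x$2 * y$1) * (- x$2)"
      "(x$1 * x$1 + x$2 * x$2) * y$2 = (x$1 * y$2 - x$2 * y$1) * x$1"
      using assms(1) unfolding inner_real2 by algebra+
    then show ?thesis using n by (simp add: vec2_eq_iff inner_real2 field_simps)
  qed
  then show ?thesis using that by blast
qed

lemma orthogonal_both_eq_0: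
  assumes "x \<bullet> z = 0" "rot x \<bullet> z = 0" "x \<noteq> 0"
  shows "z = 0"
proof -
  obtain s where s: "z = s *\<^sub>R rot x" using assms orthogonal_eq_rot by blast
  then have "s *\<^sub>R (rot x \<bullet> rot x) = 0" using assms(2) by simp
  then show ?thesis using s assms(3) by auto
qed

section \<open>The rigidity matrix of a point-line graph\<close>

text \<open>Only the values at points \<open>v\<close> in \<open>S\<close> matter; they form the row of the rigidity matrix
  for the edge \<open>e\<close>. The row is affine in \<open>p\<close>, and its linear part is the row for \<open>a = 0\<close>.\<close>

definition rig_row :: "'v set \<Rightarrow> ('v \<Rightarrow> real^2) \<Rightarrow> ('v \<Rightarrow> real^2) \<Rightarrow> 'v set \<Rightarrow> 'v \<Rightarrow> real^2"
  where "rig_row S a p e v =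
    (if v \<in> e then let w = the_elem (e - {v}) in if w \<in> S then p v - p w else a w else 0)"

lemma rig_row_PP:
  assumes "i \<in> S" "j \<in> S" "i \<noteq> j"
  shows "rig_row S a p {i, j} v = (if v = i then p i - p j else if v = j then p j - p i else 0)"
proof -
  have "{i, j} - {i} = {j}" "{i, j} - {j} = {i}" using assms by auto
  then show ?thesis using assms by (auto simp: rig_row_def)
qed

lemma rig_row_PL:
  assumes "i \<in> S" "j \<notin> S" "v \<in> S"
  shows "rig_row S a p {i, j} v = (if v = i then a j else 0)"
proof -
  have "{i, j} - {i} = {j}" using assms by auto
  then show ?thesis using assms by (auto simp: rig_row_def)
qed

lemma rig_row_affine:
  "rig_row S a (\<lambda>v. p v + t *\<^sub>R k v) e v = rig_row S a p e v + t *\<^sub>R rig_row S (\<lambda>_. 0) k e v"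
  by (auto simp: rig_row_def Let_def algebra_simps)

lemma pairing_rig_row_PP:
  assumes "finite S" "i \<in> S" "j \<in> S" "i \<noteq> j"
  shows "pairing S (rig_row S a p {i, j}) y = (p i - p j) \<bullet> (y i - y j)"
proof -
  have "pairing S (rig_row S a p {i, j}) y = pairing {i, j} (rig_row S a p {i, j}) y"
    using assms by (intro pairing_mono_neutral) (auto simp: rig_row_PP)
  then show ?thesis using assms by (simp add: pairing_def rig_row_PP algebra_simps)
qed

lemma pairing_rig_row_PL:
  assumes "finite S" "i \<in> S" "j \<notin> S"
  shows "pairing S (rig_row S a p {i, j}) y = a j \<bullet> y i"
proof -
  have "pairing S (rig_row S a p {i, j}) y = pairing {i} (rig_row S a p {i, j}) y"
    using assms by (intro pairing_mono_neutral) (auto simp: rig_row_PL)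
  then show ?thesis using assms by (simp add: pairing_def rig_row_PL)
qed

locale pl_graph_normals =
  fixes G :: "'v pl_graph" and a :: "'v \<Rightarrow> real^2"
  assumes graph: "point_line_graph G"
    and unit: "\<And>j. j \<in> lines G \<Longrightarrow> norm (a j) = 1"
begin

abbreviation "edge_row \<equiv> rig_row (points G) a"
abbreviation "edge_row0 \<equiv> rig_row (points G) (\<lambda>_. 0)"

lemma finite_points: "finite (points G)" and disjoint: "v \<in> points G \<Longrightarrow> v \<notin> lines G"
  using graph by (auto simp: point_line_graph_def)

lemma finite_edges: "finite (edges G)"
proof -
  have "edges G \<subseteq> Pow (points G \<union> lines G)" using graph by (auto simp: point_line_graph_def)
  then show ?thesis using graph finite_subset by (auto simp: point_line_graph_def)
qed

lemma edge_cases [consumes 1, case_names PP PL LL]: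
  assumes "e \<in> edges G"
  obtains i j where "e = {i, j}" "i \<in> points G" "j \<in> points G" "i \<noteq> j"
    | i j where "e = {i, j}" "i \<in> points G" "j \<in> lines G" "j \<notin> points G"
    | i j where "e = {i, j}" "i \<in> lines G" "j \<in> lines G" "i \<notin> points G" "j \<notin> points G"
proof -
  have "card e = 2" "e \<subseteq> points G \<union> lines G" using assms graph by (auto simp: point_line_graph_def)
  then obtain i j where "e = {i, j}" "i \<noteq> j" "i \<in> points G \<union> lines G" "j \<in> points G \<union> lines G"
    by (auto simp: card_2_iff)
  moreover from this have "e = {j, i}" by blast
  ultimately show ?thesis using that disjoint by blast
qed

text \<open>With the normals replaced by 0, a point-point edge \<open>{i, j}\<close> contributes
  \<open>(k i - k j) \<bullet> (y i - y j)\<close> and every other edge contributes 0. The symmetry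
  later exchanges the direction of a perturbation with a motion.\<close>

lemma pairing_symmetric_row0:
  assumes "e \<in> edges G"
  shows "pairing (points G) (edge_row0 k e) y = pairing (points G) (edge_row0 y e) k"
  using assms
proof (cases rule: edge_cases)
  case (LL i j)
  then show ?thesis unfolding pairing_def
    by (intro sum.cong) (auto simp: rig_row_def)
qed (auto simp: pairing_rig_row_PP pairing_rig_row_PL finite_points inner_commute)

lemma fixed_line_motion_iff:
  assumes "\<And>j. j \<in> lines G \<Longrightarrow> fst (l j) = a j"
  shows "fixed_line_motion G p l y \<longleftrightarrow> (\<forall>e\<in>edges G. pairing (points G) (edge_row p e) y = 0)"
proof
  assume m: "fixed_line_motion G p l y"
  show "\<forall>e\<in>edges G. pairing (points G) (edge_row p e) y = 0"
  proof
    fix e assume "e \<in> edges G"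
    then show "pairing (points G) (edge_row p e) y = 0"
    proof (cases rule: edge_cases)
      case (PP i j)
      then have "{i, j} \<in> E_PP G" using \<open>e \<in> edges G\<close> by (auto simp: E_PP_def)
      then show ?thesis using m PP by (auto simp: fixed_line_motion_def pairing_rig_row_PP finite_points)
    next
      case (PL i j)
      then have "{i, j} \<in> E_PL G" using \<open>e \<in> edges G\<close> by (auto simp: E_PL_def)
      then show ?thesis using m PL assms
        by (auto simp: fixed_line_motion_def pairing_rig_row_PL finite_points inner_commute)
    next
      \<comment> \<open>A line-line edge has a zero row, matching the absence of a condition in
        \<open>fixed_line_motion\<close>.\<close>
      case (LL i j)
      then show ?thesis unfolding pairing_def by (auto simp: rig_row_def intro!: sum.neutral)
    qed
  qed
next
  assume r: "\<forall>e\<in>edges G. pairing (points G) (edge_row p e) y = 0"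
  have 1: "(p i - p j) \<bullet> (y i - y j) = 0" if "{i, j} \<in> E_PP G" for i j
  proof -
    have "i \<in> points G" "j \<in> points G" "{i, j} \<in> edges G"
      using that by (auto simp: E_PP_def doubleton_eq_iff insert_commute)
    moreover from this have "i \<noteq> j" using graph by (auto simp: point_line_graph_def)
    ultimately show ?thesis using r pairing_rig_row_PP[of "points G" i j a p y] finite_points by auto
  qed
  have 2: "y i \<bullet> fst (l j) = 0" if "i \<in> points G" "j \<in> lines G" "{i, j} \<in> E_PL G" for i j
  proof -
    have "{i, j} \<in> edges G" using that by (auto simp: E_PL_def)
    moreover have "j \<notin> points G" using that disjoint by auto
    ultimately show ?thesis using r that pairing_rig_row_PL[of "points G" i j a p y] finite_points assms
      by (auto simp: inner_commute)
  qed
  show "fixed_line_motion G p l y" using 1 2 by (simp add: fixed_line_motion_def)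
qed

lemma rigid_iff:
  assumes "\<And>j. j \<in> lines G \<Longrightarrow> fst (l j) = a j"
  shows "inf_fixed_line_rigid G p l \<longleftrightarrow>
    (\<forall>y. (\<forall>e\<in>edges G. pairing (points G) (edge_row p e) y = 0) \<longrightarrow> (\<forall>i\<in>points G. y i = 0))"
  using fixed_line_motion_iff[OF assms] by (auto simp: inf_fixed_line_rigid_def)

end

text \<open>Deleting an edge keeps the points and hence all other rows, so \<open>rigid_iff\<close>
  applies to the smaller graph.\<close>

lemma (in pl_graph_normals) rigid_delete_iff:
  assumes "\<And>j. j \<in> lines G \<Longrightarrow> fst (l j) = a j"
  shows "inf_fixed_line_rigid (delete_edge G e) p l \<longleftrightarrow>
    (\<forall>y. (\<forall>f\<in>edges G - {e}. pairing (points G) (edge_row p f) y = 0) \<longrightarrow> (\<forall>i\<in>points G. y i = 0))"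
proof -
  interpret D: pl_graph_normals "delete_edge G e" a
    using graph unit by unfold_locales (auto simp: point_line_graph_def delete_edge_def)
  show ?thesis using D.rigid_iff[of l] assms by (simp add: delete_edge_def)
qed

context pl_graph_normals
begin

text \<open>A row that occurs in a relation is redundant, so minimality forces independence.\<close>

lemma min_rigid_imp_independent:
  assumes l: "\<And>j. j \<in> lines G \<Longrightarrow> fst (l j) = a j" and min: "min_inf_fixed_line_rigid G p l"
  shows "\<not> row_dependent (points G) (edge_row p) (edges G)"
proof
  assume "row_dependent (points G) (edge_row p) (edges G)"
  then obtain c e where c: "relation (points G) (edge_row p) (edges G) c" and e: "e \<in> edges G" "c e \<noteq> 0"
    by (auto simp: row_dependent_def)
  have "pairing (points G) (edge_row p e) y = 0"
    if "\<forall>f\<in>edges G - {e}. pairing (points G) (edge_row p f) y = 0" for y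
  proof -
    have "(\<Sum>f\<in>edges G. c f * pairing (points G) (edge_row p f) y) = c e * pairing (points G) (edge_row p e) y"
      using that e finite_edges by (subst sum.remove[of _ e]) auto
    then show ?thesis using pairing_relation[OF c, of y] e by simp
  qed
  then have "inf_fixed_line_rigid (delete_edge G e) p l"
    using min rigid_iff[OF l] rigid_delete_iff[OF l] e
    by (metis (full_types) DiffI min_inf_fixed_line_rigid_def singletonD)
  then show False using min e by (auto simp: min_inf_fixed_line_rigid_def)
qed

lemma exists_motion_if_few_edges:
  assumes "F \<subseteq> edges G" "card F < 2 * card (points G)"
  obtains y v where "\<And>e. e \<in> F \<Longrightarrow> pairing (points G) (edge_row p e) y = 0"
    "v \<in> points G" "y v \<noteq> 0"
proof -
  have fin: "finite (edge_row p ` F)" using assms(1) finite_edges finite_subset by blast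
  have "card (edge_row p ` F) \<le> card F"
    using assms(1) finite_edges finite_subset card_image_le by blast
  then have "card (edge_row p ` F) < DIM(real^2) * card (points G)" using assms(2) by simp
  from exists_common_kernel[OF fin finite_points this] obtain y where
    "\<exists>v\<in>points G. y v \<noteq> 0" "\<And>f. f \<in> edge_row p ` F \<Longrightarrow> pairing (points G) f y = 0" by metis
  then show ?thesis using that by blast
qed

text \<open>The matrix has \<open>2 * card (points G)\<close> columns: more rows are dependent,
  fewer leave a nonzero motion. In the square case independence kills all motions, and deleting a
  row makes the system underdetermined.\<close>

lemma min_rigid_iff:
  assumes l: "\<And>j. j \<in> lines G \<Longrightarrow> fst (l j) = a j"
  shows "min_inf_fixed_line_rigid G p l \<longleftrightarrow>
    card (edges G) = 2 * card (points G) \<and> \<not> row_dependent (points G) (edge_row p) (edges G)"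
proof
  assume min: "min_inf_fixed_line_rigid G p l"
  note ind = min_rigid_imp_independent[OF l min]
  have "card (edges G) \<le> 2 * card (points G)"
  proof (rule ccontr)
    assume "\<not> ?thesis"
    then have "DIM(real^2) * card (points G) < card (edges G)" by simp
    then show False
      using row_dependent_if_many[OF finite_edges finite_points] ind by blast
  qed
  moreover have "2 * card (points G) \<le> card (edges G)"
  proof (rule ccontr)
    assume "\<not> ?thesis"
    then have "card (edges G) < 2 * card (points G)" by simp
    from exists_motion_if_few_edges[OF subset_refl this] obtain y v where
      "\<And>e. e \<in> edges G \<Longrightarrow> pairing (points G) (edge_row p e) y = 0"
      "v \<in> points G" "y v \<noteq> 0" by blast
    moreover have "inf_fixed_line_rigid G p l" using min by (simp add: min_inf_fixed_line_rigid_def)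
    ultimately show False using rigid_iff[OF l, of p] by auto
  qed
  ultimately show "card (edges G) = 2 * card (points G) \<and>
      \<not> row_dependent (points G) (edge_row p) (edges G)"
    using ind by simp
next
  assume r: "card (edges G) = 2 * card (points G) \<and>
    \<not> row_dependent (points G) (edge_row p) (edges G)"
  then have card: "card (edges G) = DIM(real^2) * card (points G)" by simp
  have "y i = 0" if "\<forall>e\<in>edges G. pairing (points G) (edge_row p e) y = 0" "i \<in> points G" for y i
    by (rule kernel_trivial_if_square_independent[OF finite_edges finite_points card])
      (use r that in auto)
  then have "inf_fixed_line_rigid G p l" using rigid_iff[OF l, of p] by auto
  moreover have "\<not> inf_fixed_line_rigid (delete_edge G e) p l" if "e \<in> edges G" for e
  proof -
    have "card (edges G - {e}) < 2 * card (points G)"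
      using that finite_edges r by (metis card_Diff1_less)
    from exists_motion_if_few_edges[OF Diff_subset this] obtain y v where
      "\<And>f. f \<in> edges G - {e} \<Longrightarrow> pairing (points G) (edge_row p f) y = 0"
      "v \<in> points G" "y v \<noteq> 0" by blast
    then show ?thesis using rigid_delete_iff[OF l, of e p] by auto
  qed
  ultimately show "min_inf_fixed_line_rigid G p l" by (simp add: min_inf_fixed_line_rigid_def)
qed

section \<open>Perturbations and generic placements\<close>

text \<open>The step size \<open>1 / (n + 1)\<close> tends to 0 but is never 0, so it can be
  cancelled from identities.\<close>

abbreviation perturb :: "('v \<Rightarrow> real^2) \<Rightarrow> ('v \<Rightarrow> real^2) \<Rightarrow> nat \<Rightarrow> 'v \<Rightarrow> real^2"
  where "perturb p k n \<equiv> \<lambda>v. p v + inverse (real (Suc n)) *\<^sub>R k v"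

text \<open>The index map \<open>q\<close> serves both for an extracted subsequence and for a shift
  of the index.\<close>

lemma tendsto_perturb_row:
  assumes "strict_mono q"
  shows "(\<lambda>n. edge_row (perturb p k (q n)) e v) \<longlonglongrightarrow> edge_row p e v"
proof -
  have "((\<lambda>n. inverse (real (Suc n))) \<circ> q) \<longlonglongrightarrow> 0"
    by (intro LIMSEQ_subseq_LIMSEQ[OF LIMSEQ_inverse_real_of_nat assms])
  then have "(\<lambda>n. edge_row p e v + inverse (real (Suc (q n))) *\<^sub>R edge_row0 k e v)
      \<longlonglongrightarrow> edge_row p e v + 0 *\<^sub>R edge_row0 k e v"
    unfolding o_def by (intro tendsto_intros)
  then show ?thesis by (simp add: rig_row_affine)
qed

text \<open>Infinitely many dependent perturbations would yield a dependence at \<open>p\<close> in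
  the limit.\<close>

lemma eventually_row_independent:
  assumes "\<not> row_dependent (points G) (edge_row p) F" "F \<subseteq> edges G"
  shows "\<forall>\<^sub>F n in sequentially. \<not> row_dependent (points G) (edge_row (perturb p k n)) F"
proof (rule ccontr)
  assume "\<not> ?thesis"
  then have "infinite {n. row_dependent (points G) (edge_row (perturb p k n)) F}"
    unfolding not_eventually not_not cofinite_eq_sequentially[symmetric] frequently_cofinite .
  from infinite_enumerate[OF this] obtain q :: "nat \<Rightarrow> nat" where
    q: "strict_mono q" "\<forall>n. q n \<in> {n. row_dependent (points G) (edge_row (perturb p k n)) F}"
    by (elim exE conjE)
  have dep: "row_dependent (points G) (edge_row (perturb p k (q n))) F" for n
    using spec[OF q(2), of n] by (rule CollectD)
  have "row_dependent (points G) (edge_row p) F"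
    by (rule row_dependent_limit[where R = "\<lambda>n. edge_row (perturb p k (q n))" and S = "points G",
            OF finite_subset[OF assms(2) finite_edges] dep tendsto_perturb_row[OF q(1)]])
      (unfold row_dependent_def, blast)
  then show False using assms by simp
qed

text \<open>Independence is an open condition, so a placement that makes as many edge sets as
  possible independent is generic: nearby placements have the same dependent sets.\<close>

lemma exists_generic_placement:
  "\<exists>p. \<forall>F k. F \<subseteq> edges G \<longrightarrow> row_dependent (points G) (edge_row p) F \<longrightarrow>
    (\<forall>\<^sub>F n in sequentially. row_dependent (points G) (edge_row (perturb p k n)) F)"
proof -
  define I where "I p = {F. F \<subseteq> edges G \<and> \<not> row_dependent (points G) (edge_row p) F}" for p
  have finI: "finite (I p)" for p
    by (rule finite_subset[of _ "Pow (edges G)"]) (auto simp: I_def finite_edges)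
  have "card (I p) < Suc (card (Pow (edges G)))" for p
    using card_mono[of "Pow (edges G)" "I p"] finite_edges by (auto simp: I_def less_Suc_eq_le)
  \<comment> \<open>The placement \<open>p\<close> maximises the number of independent edge sets,
    which is bounded by the number of all edge sets.\<close>
  then obtain p where p: "\<And>p'. card (I p') \<le> card (I p)"
    using ex_has_greatest_nat[of "\<lambda>_. True" undefined "\<lambda>p. card (I p)"] by blast
  have "\<forall>\<^sub>F n in sequentially. row_dependent (points G) (edge_row (perturb p k n)) F"
    if F: "F \<subseteq> edges G" "row_dependent (points G) (edge_row p) F" for F k
  proof -
    have "\<forall>\<^sub>F n in sequentially. \<forall>D\<in>I p. \<not> row_dependent (points G) (edge_row (perturb p k n)) D"
      using eventually_row_independent finI by (intro eventually_ball_finite) (auto simp: I_def)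
    then show ?thesis
    proof eventually_elim
      case (elim n)
      \<comment> \<open>All sets in \<open>I p\<close> stay independent, so by maximality no new
        independent set appears.\<close>
      then have "I p \<subseteq> I (perturb p k n)" by (auto simp: I_def)
      then have "I p = I (perturb p k n)" using p finI by (simp add: card_seteq)
      then show ?case using F by (auto simp: I_def)
    qed
  qed
  then show ?thesis by (intro exI[of _ p] allI impI)
qed

end

section \<open>Circuits at a generic placement\<close>

locale generic_circuit = pl_graph_normals +
  fixes p :: "'a \<Rightarrow> real^2" and C :: "'a set set" and c :: "'a set \<Rightarrow> real"
  assumes generic: "\<And>F k. F \<subseteq> edges G \<Longrightarrow> row_dependent (points G) (edge_row p) F \<Longrightarrow>
      \<forall>\<^sub>F n in sequentially. row_dependent (points G) (edge_row (perturb p k n)) F"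
    and C_edges: "C \<subseteq> edges G"
    and minimal: "\<And>D. D \<subset> C \<Longrightarrow> \<not> row_dependent (points G) (edge_row p) D"
    and rel: "relation (points G) (edge_row p) C c"
    and rel_nontrivial: "\<exists>e\<in>C. c e \<noteq> 0"
begin

lemma finite_C: "finite C"
  using C_edges finite_edges finite_subset by blast

lemma relation_unique:
  assumes "relation (points G) (edge_row p) C d"
  obtains s where "\<And>e. e \<in> C \<Longrightarrow> d e = s * c e"
  using circuit_relation_unique[OF finite_C minimal rel rel_nontrivial assms] by blast

lemma c_nonzero: "e \<in> C \<Longrightarrow> c e \<noteq> 0"
  using circuit_relation_nonzero[OF finite_C minimal rel rel_nontrivial] by blast

abbreviation motion :: "('a \<Rightarrow> real^2) \<Rightarrow> bool"
  where "motion y \<equiv> \<forall>e\<in>C. pairing (points G) (edge_row p e) y = 0"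

text \<open>Since \<open>C\<close> stays dependent along \<open>p + t k\<close>, the relation can be differentiated in
  direction \<open>k\<close>; a motion annihilates the term with the derivative of the coefficients.
  Only the limit of normalised relations is used, so no differentiability is needed.\<close>

lemma relation_pairing_row0:
  assumes y: "motion y"
  shows "(\<Sum>e\<in>C. c e * pairing (points G) (edge_row0 k e) y) = 0"
proof -
  have "row_dependent (points G) (edge_row p) C" using rel rel_nontrivial by (auto simp: row_dependent_def)
  then obtain N where N: "\<And>n. n \<ge> N \<Longrightarrow> row_dependent (points G) (edge_row (perturb p k n)) C"
    using generic[OF C_edges, of k] by (auto simp: eventually_sequentially)
  \<comment> \<open>Dependence is only guaranteed from \<open>N\<close> on, hence the shift of the
    sequence.\<close>
  have shift: "strict_mono (\<lambda>n::nat. n + N)" by (simp add: strict_mono_def)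
  have dep: "row_dependent (points G) (edge_row (perturb p k (n + N))) C" for n
    by (rule N) simp
  have "\<exists>r cn d. strict_mono (r :: nat \<Rightarrow> nat) \<and>
      (\<forall>n. relation (points G) (edge_row (perturb p k (n + N))) C (cn n)) \<and>
      (\<forall>e\<in>C. (\<lambda>n. cn (r n) e) \<longlonglongrightarrow> d e) \<and>
      relation (points G) (edge_row p) C d \<and> (\<exists>e\<in>C. d e \<noteq> 0)"
    by (rule row_dependent_limit[where R = "\<lambda>n. edge_row (perturb p k (n + N))" and S = "points G",
            OF finite_C dep tendsto_perturb_row[OF shift]]) blast
  then obtain r cn d where r: "strict_mono (r :: nat \<Rightarrow> nat)"
    "\<forall>n. relation (points G) (edge_row (perturb p k (n + N))) C (cn n)"
    "\<forall>e\<in>C. (\<lambda>n. cn (r n) e) \<longlonglongrightarrow> d e"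
    "relation (points G) (edge_row p) C d" "\<exists>e\<in>C. d e \<noteq> 0"
    by (elim exE conjE)
  \<comment> \<open>The motion \<open>y\<close> annihilates the rows at \<open>p\<close>; what
    remains is the pairing with the linear parts times the nonzero step \<open>t\<close>.\<close>
  have zero: "(\<Sum>e\<in>C. cn n e * pairing (points G) (edge_row0 k e) y) = 0" for n
  proof -
    define t where "t = inverse (real (Suc (n + N)))"
    have "0 = (\<Sum>e\<in>C. cn n e * pairing (points G) (edge_row (perturb p k (n + N)) e) y)"
      using pairing_relation[OF spec[OF r(2), of n]] by simp
    also have "\<dots> = (\<Sum>e\<in>C. t * (cn n e * pairing (points G) (edge_row0 k e) y))"
    proof (intro sum.cong refl)
      fix e assume "e \<in> C"
      have "pairing (points G) (edge_row (perturb p k (n + N)) e) y =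
          pairing (points G) (edge_row p e) y + t * pairing (points G) (edge_row0 k e) y"
        unfolding rig_row_affine pairing_def t_def
        by (simp add: inner_add_left sum.distrib sum_distrib_left)
      then show "cn n e * pairing (points G) (edge_row (perturb p k (n + N)) e) y =
          t * (cn n e * pairing (points G) (edge_row0 k e) y)"
        using y \<open>e \<in> C\<close> by simp
    qed
    also have "\<dots> = t * (\<Sum>e\<in>C. cn n e * pairing (points G) (edge_row0 k e) y)"
      by (simp add: sum_distrib_left)
    finally show ?thesis by (simp add: t_def)
  qed
  have "(\<lambda>n. \<Sum>e\<in>C. cn (r n) e * pairing (points G) (edge_row0 k e) y)
      \<longlonglongrightarrow> (\<Sum>e\<in>C. d e * pairing (points G) (edge_row0 k e) y)"
    using r by (intro tendsto_intros) auto
  then have d0: "(\<Sum>e\<in>C. d e * pairing (points G) (edge_row0 k e) y) = 0"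
    unfolding zero by (simp add: LIMSEQ_const_iff)
  \<comment> \<open>The limit coefficients \<open>d\<close> may differ from \<open>c\<close>, but
    only by a nonzero factor.\<close>
  obtain s where s: "\<And>e. e \<in> C \<Longrightarrow> d e = s * c e" using relation_unique[OF r(4)] by blast
  have "s \<noteq> 0" using s r(5) by auto
  have "s * (\<Sum>e\<in>C. c e * pairing (points G) (edge_row0 k e) y) = 0"
    using d0 s by (simp add: sum_distrib_left mult.assoc cong: sum.cong)
  then show ?thesis using \<open>s \<noteq> 0\<close> by simp
qed

text \<open>The direction \<open>k\<close> is arbitrary and can be exchanged with the motion
  \<open>y\<close>. Concentrating it at one vertex turns the scalar identity into a vector identity
  there.\<close>

lemma relation_row0:
  assumes y: "motion y"
  shows "relation (points G) (edge_row0 y) C c"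
  unfolding relation_def
proof
  fix v assume v: "v \<in> points G"
  \<comment> \<open>Taking the sum itself as the displacement of \<open>v\<close> gives
    \<open>b \<bullet> b = 0\<close>.\<close>
  define b where "b = (\<Sum>e\<in>C. c e *\<^sub>R edge_row0 y e v)"
  define k where "k u = (if u = v then b else 0)" for u
  have "pairing (points G) (edge_row0 k e) y = edge_row0 y e v \<bullet> b" if "e \<in> C" for e
  proof -
    have "pairing (points G) (edge_row0 k e) y = pairing (points G) (edge_row0 y e) k"
      using that C_edges by (intro pairing_symmetric_row0) auto
    also have "\<dots> = pairing {v} (edge_row0 y e) k"
      using v finite_points by (intro pairing_mono_neutral) (auto simp: k_def)
    finally show ?thesis by (simp add: pairing_def k_def)
  qed
  then have "0 = (\<Sum>e\<in>C. c e * (edge_row0 y e v \<bullet> b))"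
    using relation_pairing_row0[OF y, of k] by (simp cong: sum.cong)
  also have "\<dots> = b \<bullet> b" by (simp add: b_def inner_sum_left)
  finally show "(\<Sum>e\<in>C. c e *\<^sub>R edge_row0 y e v) = 0" by (simp add: b_def)
qed

text \<open>Coincident end points would make the row zero, so \<open>C\<close> would be this edge
  alone and every velocity field a motion. A field moving only \<open>i\<close> then contradicts
  \<open>relation_row0\<close>, as \<open>c {i, j} \<noteq> 0\<close>.\<close>

lemma PP_edge_distinct:
  assumes "{i, j} \<in> C" "i \<in> points G" "j \<in> points G"
  shows "i \<noteq> j" "p i \<noteq> p j"
proof -
  have "card {i, j} = 2" using assms C_edges graph by (auto simp: point_line_graph_def)
  then show ij: "i \<noteq> j" by auto
  show "p i \<noteq> p j"
  proof
    assume eq: "p i = p j"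
    have "relation (points G) (edge_row p) {{i, j}} (\<lambda>_. 1)"
      using assms ij eq by (simp add: relation_def rig_row_PP)
    then have "row_dependent (points G) (edge_row p) {{i, j}}"
      unfolding row_dependent_def by (intro exI[of _ "\<lambda>_. 1"]) simp
    then have C: "C = {{i, j}}" using minimal[of "{{i, j}}"] assms by blast
    define b :: "real^2" where "b = axis 1 1"
    define y where "y v = (if v = i then b else 0)" for v
    have "motion y" using assms ij eq finite_points by (simp add: C pairing_rig_row_PP)
    then have "c {i, j} *\<^sub>R b = 0"
      using relation_row0[of y] assms ij by (auto simp: relation_def C rig_row_PP y_def)
    then show False using c_nonzero[OF assms(1)] by (simp add: b_def)
  qed
qed

text \<open>For a point-point edge the factor \<open>t e\<close> is its angular velocity under
  \<open>y\<close>; an edge with a line end has zero linear part and allows \<open>t e = 0\<close>.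
  The products \<open>c e * t e\<close> form a relation at \<open>p\<close>, so uniqueness makes
  \<open>t\<close> constant.\<close>

lemma motion_rotation:
  assumes y: "motion y"
  shows "\<exists>s. (\<forall>i\<in>points G. \<forall>j\<in>points G. {i, j} \<in> C \<longrightarrow> y i - y j = s *\<^sub>R rot (p i - p j)) \<and>
    (\<forall>e\<in>C. \<not> e \<subseteq> points G \<longrightarrow> s = 0)"
proof -
  have "\<exists>t. (\<forall>v\<in>points G. edge_row0 y e v = t *\<^sub>R rot (edge_row p e v)) \<and> (\<not> e \<subseteq> points G \<longrightarrow> t = 0)"
    if e: "e \<in> C" for e
  proof -
    have "e \<in> edges G" using e C_edges by blast
    then show ?thesis
    proof (cases rule: edge_cases)
      case (PP i j)
      have "p i - p j \<noteq> 0" using PP_edge_distinct[of i j] PP e by simp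
      moreover have "(p i - p j) \<bullet> (y i - y j) = 0"
        using y e PP pairing_rig_row_PP[of "points G" i j a p y] finite_points by auto
      ultimately obtain t where "y i - y j = t *\<^sub>R rot (p i - p j)"
        using orthogonal_eq_rot by blast
      moreover from this have "y j - y i = t *\<^sub>R rot (p j - p i)"
        by (metis minus_diff_eq rot_linear(2) scaleR_minus_right)
      ultimately show ?thesis using PP by (auto simp: rig_row_PP rot_linear intro!: exI[of _ t])
    next
      case (PL i j)
      then show ?thesis by (intro exI[of _ 0]) (auto simp: rig_row_PL)
    next
      case (LL i j)
      then show ?thesis by (intro exI[of _ 0]) (auto simp: rig_row_def)
    qed
  qed
  then obtain t where t: "\<And>e v. e \<in> C \<Longrightarrow> v \<in> points G \<Longrightarrow> edge_row0 y e v = t e *\<^sub>R rot (edge_row p e v)"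
    "\<And>e. e \<in> C \<Longrightarrow> \<not> e \<subseteq> points G \<Longrightarrow> t e = 0"
    by metis
  have "relation (points G) (edge_row p) C (\<lambda>e. c e * t e)"
    unfolding relation_def
  proof
    fix v assume v: "v \<in> points G"
    have "rot (\<Sum>e\<in>C. (c e * t e) *\<^sub>R edge_row p e v) = (\<Sum>e\<in>C. c e *\<^sub>R edge_row0 y e v)"
      unfolding rot_sum using t v by (intro sum.cong) (auto simp: rot_linear)
    also have "\<dots> = 0" using relation_row0[OF y] v by (simp add: relation_def)
    finally show "(\<Sum>e\<in>C. (c e * t e) *\<^sub>R edge_row p e v) = 0" by simp
  qed
  then obtain s where "\<And>e. e \<in> C \<Longrightarrow> c e * t e = s * c e" using relation_unique by blast
  then have s: "t e = s" if "e \<in> C" for e using that c_nonzero[OF that] by (metis mult.commute mult_cancel_left)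
  show ?thesis
  proof (intro exI conjI ballI impI)
    fix i j assume ij: "i \<in> points G" "j \<in> points G" "{i, j} \<in> C"
    have "edge_row0 y {i, j} i = s *\<^sub>R rot (edge_row p {i, j} i)" using t(1) s ij by blast
    then show "y i - y j = s *\<^sub>R rot (p i - p j)"
      using ij PP_edge_distinct(1)[OF ij(3,1,2)] by (simp add: rig_row_PP)
  next
    fix e assume "e \<in> C" "\<not> e \<subseteq> points G"
    then show "s = 0" using t(2) s by metis
  qed
qed

text \<open>The edges meeting a level set of \<open>z\<close> carry a relation on their own, so by minimality
  they are all of \<open>C\<close>.\<close>

lemma constant_on_circuit:
  assumes z: "\<And>i j. {i, j} \<in> C \<Longrightarrow> i \<in> points G \<Longrightarrow> j \<in> points G \<Longrightarrow> z i = z j"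
    and v0: "v0 \<in> points_of G C" and v: "v \<in> points_of G C"
  shows "z v = z v0"
proof -
  have same: "z u = z w" if "e \<in> C" "u \<in> e" "w \<in> e" "u \<in> points G" "w \<in> points G" for e u w
  proof (cases "u = w")
    case False
    have "card e = 2" using that(1) C_edges graph by (auto simp: point_line_graph_def)
    then have "e = {u, w}" using that False by (auto simp: card_2_iff)
    then show ?thesis using z that by blast
  qed simp
  define K where "K = {v \<in> points G. z v = z v0}"
  define d where "d e = (if e \<inter> K \<noteq> {} then c e else 0)" for e
  have "relation (points G) (edge_row p) C d"
    unfolding relation_def
  proof
    fix u assume u: "u \<in> points G"
    show "(\<Sum>e\<in>C. d e *\<^sub>R edge_row p e u) = 0"
    proof (cases "u \<in> K")
      case True
      \<comment> \<open>Every edge at a vertex of \<open>K\<close> meets \<open>K\<close>, so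
        \<open>d\<close> agrees with \<open>c\<close> there.\<close>
      have "(\<Sum>e\<in>C. d e *\<^sub>R edge_row p e u) = (\<Sum>e\<in>C. c e *\<^sub>R edge_row p e u)"
        using True by (intro sum.cong) (auto simp: d_def rig_row_def)
      then show ?thesis using rel u by (simp add: relation_def)
    next
      case False
      have "d e *\<^sub>R edge_row p e u = 0" if e: "e \<in> C" for e
      proof (cases "u \<in> e")
        case True
        have "w \<notin> K" if "w \<in> e" for w
          using same[OF e True that] u False unfolding K_def by auto
        then have "d e = 0" unfolding d_def by auto
        then show ?thesis by simp
      qed (simp add: rig_row_def)
      then show ?thesis by (intro sum.neutral ballI)
    qed
  qed
  then obtain s where s: "\<And>e. e \<in> C \<Longrightarrow> d e = s * c e" using relation_unique by blast
  obtain e0 where e0: "e0 \<in> C" "v0 \<in> e0" "v0 \<in> points G" using v0 by (auto simp: points_of_def)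
  then have "d e0 = c e0" by (auto simp: d_def K_def)
  \<comment> \<open>The edge \<open>e0\<close> keeps its coefficient, which determines the factor;
    so \<open>d\<close> vanishes on no edge of \<open>C\<close>.\<close>
  then have "s = 1" using s[OF e0(1)] c_nonzero[OF e0(1)] by simp
  obtain e where e: "e \<in> C" "v \<in> e" "v \<in> points G" using v by (auto simp: points_of_def)
  have "d e \<noteq> 0" using s[OF e(1)] c_nonzero[OF e(1)] \<open>s = 1\<close> by simp
  then obtain u where u: "u \<in> e" "u \<in> points G" "z u = z v0"
    unfolding d_def K_def by (auto split: if_splits)
  then show ?thesis using same[OF e(1,2) u(1) e(3) u(2)] by simp
qed

text \<open>One row of a circuit is redundant, which accounts for the \<open>+ 1\<close>. If the
  other rows and the pins in \<open>\<Psi>\<close> were fewer than the unknowns, some nonzero motion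
  of \<open>C\<close> would satisfy all pins.\<close>

lemma card_circuit_ge:
  assumes "finite \<Psi>"
    and pins: "\<And>y. motion y \<Longrightarrow> (\<And>f. f \<in> \<Psi> \<Longrightarrow> pairing (points_of G C) f y = 0) \<Longrightarrow>
      (\<And>v. v \<in> points_of G C \<Longrightarrow> y v = 0)"
  shows "2 * card (points_of G C) + 1 \<le> card C + card \<Psi>"
proof (rule ccontr)
  assume less: "\<not> ?thesis"
  have P: "points_of G C \<subseteq> points G" "finite (points_of G C)"
    using finite_points by (auto simp: points_of_def)
  obtain e0 where e0: "e0 \<in> C" "c e0 \<noteq> 0" using rel_nontrivial by blast
  define \<Phi> where "\<Phi> = edge_row p ` (C - {e0}) \<union> \<Psi>"
  have "card \<Phi> \<le> card (edge_row p ` (C - {e0})) + card \<Psi>" unfolding \<Phi>_def by (rule card_Un_le)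
  also have "\<dots> \<le> card (C - {e0}) + card \<Psi>" using finite_C by (simp add: card_image_le)
  also have "\<dots> < 2 * card (points_of G C)"
    using less card_Suc_Diff1[OF finite_C e0(1)] by linarith
  finally have card: "card \<Phi> < DIM(real^2) * card (points_of G C)" by simp
  have "finite \<Phi>" using finite_C assms by (simp add: \<Phi>_def)
  from exists_common_kernel[OF this P(2) card] obtain y where y: "\<exists>v\<in>points_of G C. y v \<noteq> 0"
    "\<And>v. v \<notin> points_of G C \<Longrightarrow> y v = 0"
    "\<And>f. f \<in> \<Phi> \<Longrightarrow> pairing (points_of G C) f y = 0"
    by metis
  have "pairing (points G) f y = pairing (points_of G C) f y" for f
    using P y finite_points by (intro pairing_mono_neutral) auto
  then have 0: "pairing (points G) (edge_row p e) y = 0" if "e \<in> C - {e0}" for e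
    using y(3) that by (auto simp: \<Phi>_def)
  have "(\<Sum>e\<in>C. c e * pairing (points G) (edge_row p e) y) = c e0 * pairing (points G) (edge_row p e0) y"
    using 0 e0 finite_C by (subst sum.remove[of _ e0]) auto
  then have "pairing (points G) (edge_row p e0) y = 0" using pairing_relation[OF rel, of y] e0 by simp
  then have "motion y" using 0 by auto
  then have "y v = 0" if "v \<in> points_of G C" for v
    using that y(3) by (intro pins) (auto simp: \<Phi>_def)
  then show False using y(1) by auto
qed

end

section \<open>Necessity of the count\<close>

context pl_graph_normals
begin

lemma points_of_subset: "points_of G F \<subseteq> points G" and finite_points_of: "finite (points_of G F)"
  using finite_points by (auto simp: points_of_def)

lemma row_outside_points_of: "e \<in> F \<Longrightarrow> v \<in> points G - points_of G F \<Longrightarrow> edge_row p e v = 0"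
  by (auto simp: points_of_def rig_row_def)

lemma normal_dim_eq_0:
  assumes "lines_of G F = {}"
  shows "normal_dim G a F = 0"
  using assms by (simp add: normal_dim_def)

text \<open>Unit normals are nonzero, so they span a line or the whole plane.\<close>

lemma normal_dim_cases:
  assumes "lines_of G F \<noteq> {}"
  obtains j where "j \<in> lines_of G F" "normal_dim G a F = 1" "a ` lines_of G F \<subseteq> span {a j}"
  | "normal_dim G a F = 2" "span (a ` lines_of G F) = UNIV"
proof -
  note normal_cases = that
  let ?N = "a ` lines_of G F"
  obtain j where j: "j \<in> lines_of G F" using assms by auto
  then have "norm (a j) = 1" using unit by (auto simp: lines_of_def)
  then have aj: "a j \<noteq> 0" by auto
  have dim1: "dim {a j} = 1" using aj by (simp add: dim_eq_card_independent)
  have "dim {a j} \<le> dim ?N" using j by (intro dim_subset) auto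
  then have "dim ?N \<ge> 1" using dim1 by simp
  moreover have "dim ?N \<le> 2" using dim_subset_UNIV_cart[of ?N] by simp
  moreover have ?thesis if "dim ?N = 1"
  proof -
    have "span {a j} = span ?N"
      using j that dim1 by (intro dim_eq_span) auto
    then show ?thesis using j \<open>dim ?N = 1\<close> span_superset[of ?N]
      by (intro normal_cases(1)[of j]) (auto simp: normal_dim_def)
  qed
  moreover have ?thesis if "dim ?N = 2"
  proof -
    have "span ?N = UNIV" using that dim_eq_full[of ?N] by simp
    then show ?thesis using that by (intro normal_cases(2)) (auto simp: normal_dim_def)
  qed
  ultimately show ?thesis by linarith
qed


lemma independent_imp_row_nonzero:
  assumes "\<not> row_dependent (points G) (edge_row p) F" "F \<subseteq> edges G" "e \<in> F"
  obtains v where "v \<in> points G" "edge_row p e v \<noteq> 0"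
proof (rule ccontr)
  assume "\<not> thesis"
  then have "relation (points G) (edge_row p) {e} (\<lambda>_. 1)" using that by (auto simp: relation_def)
  then have "row_dependent (points G) (edge_row p) {e}"
    unfolding row_dependent_def by (intro exI[of _ "\<lambda>_. 1"]) simp
  then show False
    using row_independent_subset[OF assms(1), of "{e}"] assms finite_subset[OF assms(2) finite_edges]
    by simp
qed

lemma card_add_motions_le:
  fixes Y :: "'j \<Rightarrow> 'v \<Rightarrow> real^2"
  assumes ind: "\<not> row_dependent (points G) (edge_row p) F" and F: "F \<subseteq> edges G"
    and "finite J" and Y: "\<not> row_dependent (points_of G F) Y J"
    and motions: "\<And>e j. e \<in> F \<Longrightarrow> j \<in> J \<Longrightarrow> pairing (points G) (edge_row p e) (Y j) = 0"
  shows "card F + card J \<le> 2 * nu_P G F"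
proof -
  have "\<not> row_dependent (points_of G F) (edge_row p) F"
    by (rule row_independent_restrict[OF ind points_of_subset]) (rule row_outside_points_of)
  moreover have "pairing (points_of G F) (edge_row p e) (Y j) = 0" if "e \<in> F" "j \<in> J" for e j
  proof -
    have "pairing (points G) (edge_row p e) (Y j) = pairing (points_of G F) (edge_row p e) (Y j)"
      using that(1) by (intro pairing_mono_neutral finite_points points_of_subset)
        (simp add: row_outside_points_of)
    then show ?thesis using motions[OF that] by simp
  qed
  ultimately have "card F + card J \<le> DIM(real^2) * card (points_of G F)"
    using Y finite_subset[OF F finite_edges] \<open>finite J\<close> finite_points_of
    by (intro card_add_orthogonal_le)
  then show ?thesis by (simp add: nu_P_def)
qed

text \<open>The bound falls by the number of independent trivial motions: 3 without lines, 1 when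
  all normals are parallel, 0 otherwise. These are the values of \<open>3 - min 3 (2 * d)\<close>
  for normal dimension \<open>d\<close> equal to 0, 1, 2.\<close>

lemma independent_imp_sparse:
  assumes ind: "\<not> row_dependent (points G) (edge_row p) F" and F: "F \<subseteq> edges G" "F \<noteq> {}"
  shows "int (card F) \<le> 2 * int (nu_P G F) - 3 + min 3 (2 * int (normal_dim G a F))"
proof (cases "lines_of G F = {}")
  case True
  obtain e0 where e0: "e0 \<in> F" using F by blast
  have PP: "\<exists>i j. e = {i, j} \<and> i \<in> points G \<and> j \<in> points G \<and> i \<noteq> j" if "e \<in> F" for e
  proof -
    have "e \<in> edges G" using that F by blast
    then show ?thesis
    proof (cases rule: edge_cases)
      case (PP i j)
      then show ?thesis by blast
    qed (use that True in \<open>auto simp: lines_of_def\<close>)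
  qed
  obtain u w where uw: "e0 = {u, w}" "u \<in> points G" "w \<in> points G" "u \<noteq> w"
    using PP[OF e0] by blast
  \<comment> \<open>Coincident points would give \<open>e0\<close> a zero row; distinct ones keep
    the rotation independent of the translations.\<close>
  have "p u \<noteq> p w"
  proof
    assume "p u = p w"
    moreover obtain v where "v \<in> points G" "edge_row p e0 v \<noteq> 0"
      using independent_imp_row_nonzero[OF ind F(1) e0] by blast
    ultimately show False using uw by (simp add: rig_row_PP split: if_splits)
  qed
  \<comment> \<open>Two translations and the infinitesimal rotation about the origin.\<close>
  define Y :: "nat \<Rightarrow> 'v \<Rightarrow> real^2" where
    "Y n v = (if n = 0 then axis 1 1 else if n = 1 then axis 2 1 else rot (p v))" for n v
  have "\<not> row_dependent (points_of G F) Y {0, 1, 2}"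
  proof
    assume "row_dependent (points_of G F) Y {0, 1, 2}"
    then obtain c where c: "relation (points_of G F) Y {0, 1, 2} c" "\<exists>n\<in>{0, 1, 2}. c n \<noteq> 0"
      unfolding row_dependent_def by blast
    have sum0: "c 0 *\<^sub>R axis 1 1 + c 1 *\<^sub>R axis 2 1 + c 2 *\<^sub>R rot (p v) = (0::real^2)"
      if "v \<in> points_of G F" for v
      using c(1) that by (simp add: relation_def Y_def add.assoc)
    have "u \<in> points_of G F" "w \<in> points_of G F" using uw e0 by (auto simp: points_of_def)
    then have "c 2 *\<^sub>R rot (p u) = c 2 *\<^sub>R rot (p w)"
      using sum0[of u] sum0[of w] by (metis add_left_cancel)
    then have "c 2 *\<^sub>R rot (p u - p w) = 0" by (simp add: rot_linear scaleR_diff_right)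
    then have "c 2 = 0" using \<open>p u \<noteq> p w\<close> by simp
    moreover from this have "c 0 = 0 \<and> c 1 = 0"
      using sum0[OF \<open>u \<in> points_of G F\<close>] by (simp add: vec2_eq_iff axis_def)
    ultimately show False using c(2) by auto
  qed
  moreover have "pairing (points G) (edge_row p e) (Y n) = 0" if "e \<in> F" for e n
    using PP[OF that] finite_points
    by (auto simp: pairing_rig_row_PP Y_def rot_linear(2)[symmetric])
  ultimately have "card F + card {0, 1, 2::nat} \<le> 2 * nu_P G F"
    by (intro card_add_motions_le[OF ind F(1), where Y = Y]) simp_all
  then show ?thesis using normal_dim_eq_0[OF True] by simp
next
  case False
  then show ?thesis
  proof (cases rule: normal_dim_cases)
    case (1 j)
    have "norm (a j) = 1" using 1 unit by (auto simp: lines_of_def)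
    then have aj: "a j \<noteq> 0" by auto
    obtain e0 where e0: "e0 \<in> F" using F by blast
    \<comment> \<open>A nonzero row provides a point incident with \<open>F\<close>, at which the
      translation does not vanish.\<close>
    obtain v where "v \<in> points G" "edge_row p e0 v \<noteq> 0"
      using independent_imp_row_nonzero[OF ind F(1) e0] by blast
    then have v: "v \<in> points_of G F" using e0 by (auto simp: points_of_def rig_row_def split: if_splits)
    \<comment> \<open>The lines incident with \<open>F\<close> are parallel with direction
      \<open>rot (a j)\<close>, so translating along them is a motion.\<close>
    have "\<not> row_dependent (points_of G F) (\<lambda>_ _. rot (a j)) {()}"
      using v aj by (auto simp: row_dependent_def relation_def)
    moreover have "pairing (points G) (edge_row p e) (\<lambda>_. rot (a j)) = 0" if "e \<in> F" for e
    proof -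
      have "e \<in> edges G" using that F by blast
      then show ?thesis
      proof (cases rule: edge_cases)
        case (PP i k)
        then show ?thesis using finite_points by (simp add: pairing_rig_row_PP)
      next
        case (PL i k)
        then have "k \<in> lines_of G F" using that by (auto simp: lines_of_def)
        then have "a k \<in> span {a j}" using 1(3) by blast
        then obtain t where "a k = t *\<^sub>R a j" by (auto simp: span_singleton)
        then show ?thesis using PL finite_points by (simp add: pairing_rig_row_PL)
      next
        case (LL i k)
        then show ?thesis unfolding pairing_def by (auto simp: rig_row_def intro!: sum.neutral)
      qed
    qed
    ultimately have "card F + card {()} \<le> 2 * nu_P G F"
      by (intro card_add_motions_le[OF ind F(1), where Y = "\<lambda>_ _. rot (a j)"]) simp_all
    then show ?thesis using 1(2) by simp
  next
    case 2
    have "card F + card ({} :: unit set) \<le> 2 * nu_P G F"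
      by (intro card_add_motions_le[OF ind F(1), where Y = "\<lambda>_ _. 0"]) (auto simp: row_dependent_def)
    then show ?thesis using 2(1) by simp
  qed
qed

end

section \<open>Circuits violate the count\<close>

context generic_circuit
begin

text \<open>These functionals serve as pins: they stop the velocity at \<open>v\<close> in direction
  \<open>b\<close>.\<close>

lemma pairing_indicator:
  assumes "v \<in> points_of G C"
  shows "pairing (points_of G C) (\<lambda>x. if x = v then b else 0) y = b \<bullet> y v"
proof -
  have "pairing (points_of G C) (\<lambda>x. if x = v then b else 0) y = pairing {v} (\<lambda>x. if x = v then b else 0) y"
    using assms finite_points_of by (intro pairing_mono_neutral) auto
  then show ?thesis by (simp add: pairing_def)
qed

text \<open>An edge with a line end forces angular velocity 0 in \<open>motion_rotation\<close>, so
  velocities agree along point-point edges and hence on the whole circuit.\<close>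

lemma motion_constant_if_line:
  assumes "lines_of G C \<noteq> {}" "motion y" "i \<in> points_of G C" "j \<in> points_of G C"
  shows "y i = y j"
proof -
  obtain e0 where "e0 \<in> C" "\<not> e0 \<subseteq> points G"
    using assms(1) disjoint unfolding lines_of_def by blast
  then obtain s where s: "\<forall>i\<in>points G. \<forall>j\<in>points G. {i, j} \<in> C \<longrightarrow> y i - y j = s *\<^sub>R rot (p i - p j)"
    "s = 0"
    using motion_rotation[OF assms(2)] by blast
  have "y i = y j" if "{i, j} \<in> C" "i \<in> points G" "j \<in> points G" for i j
    using bspec[OF bspec[OF s(1) that(2)] that(3)] that(1) s(2) by simp
  then show ?thesis by (rule constant_on_circuit[OF _ assms(4,3)])
qed

text \<open>A point-line edge at \<open>j\<close> constrains the velocity of its own point, which is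
  shared by all points of \<open>C\<close>. The incidence hypothesis rules out a line-line edge at
  \<open>j\<close>.\<close>

lemma motion_orthogonal_normals:
  assumes "\<And>e. e \<in> C \<Longrightarrow> e \<inter> points G \<noteq> {}" "motion y" "v \<in> points_of G C" "j \<in> lines_of G C"
  shows "a j \<bullet> y v = 0"
proof -
  obtain e where e: "e \<in> C" "j \<in> e" "j \<in> lines G" using assms(4) by (auto simp: lines_of_def)
  then have "e \<in> edges G" using C_edges by blast
  then show ?thesis
  proof (cases rule: edge_cases)
    case (PP i k)
    then show ?thesis using e disjoint by blast
  next
    case (PL i k)
    then have "k = j" using e disjoint by blast
    moreover have "pairing (points G) (edge_row p {i, k}) y = 0"
      using bspec[OF assms(2) e(1)] unfolding PL(1) .
    ultimately have "a j \<bullet> y i = 0"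
      using pairing_rig_row_PL[OF finite_points PL(2,4), of a p y] by simp
    moreover have "i \<in> points_of G C" using PL e by (auto simp: points_of_def)
    then have "y v = y i"
      using assms(4) by (intro motion_constant_if_line[OF _ assms(2,3)]) auto
    ultimately show ?thesis by simp
  next
    case (LL i k)
    then show ?thesis using assms(1)[OF e(1)] by blast
  qed
qed

text \<open>Pinning the trivial motions of \<open>C\<close> leaves none, so \<open>C\<close> has too many edges for the count.\<close>

lemma card_circuit_ge_PP:
  assumes "lines_of G C = {}"
  shows "2 * nu_P G C \<le> card C + 2"
proof -
  obtain e0 where e0: "e0 \<in> C" using rel_nontrivial by blast
  then have "e0 \<in> edges G" using C_edges by blast
  then obtain u w where uw: "e0 = {u, w}" "u \<in> points G" "w \<in> points G"
  proof (cases rule: edge_cases)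
    case (PP i j)
    then show ?thesis by (intro that)
  next
    case (PL i j)
    then have "j \<in> lines_of G C" using e0 unfolding lines_of_def by auto
    then show ?thesis using assms by simp
  next
    case (LL i j)
    then have "j \<in> lines_of G C" using e0 unfolding lines_of_def by auto
    then show ?thesis using assms by simp
  qed
  then have P: "u \<in> points_of G C" "w \<in> points_of G C" using e0 unfolding points_of_def by blast+
  have uwC: "{u, w} \<in> C" using e0 uw by simp
  note puw = PP_edge_distinct[OF this uw(2,3)]
  define \<delta> where "\<delta> v b = (\<lambda>x. if x = v then b else (0::real^2))" for v :: 'a and b
  have pairing_\<delta>: "pairing (points_of G C) (\<delta> v b) y = b \<bullet> y v" if "v \<in> points_of G C" for v b y
    unfolding \<delta>_def by (rule pairing_indicator[OF that])
  \<comment> \<open>The first two pins fix \<open>w\<close>, the third prevents \<open>u\<close>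
    from rotating about it.\<close>
  define \<Psi> where "\<Psi> = {\<delta> w (axis 1 1), \<delta> w (axis 2 1), \<delta> u (rot (p u - p w))}"
  have \<Psi>: "\<delta> w (axis 1 1) \<in> \<Psi>" "\<delta> w (axis 2 1) \<in> \<Psi>" "\<delta> u (rot (p u - p w)) \<in> \<Psi>"
    unfolding \<Psi>_def by (intro insertI1 insertI2)+
  have "2 * card (points_of G C) + 1 \<le> card C + card \<Psi>"
  proof (rule card_circuit_ge)
    fix y v assume y: "motion y" "\<And>f. f \<in> \<Psi> \<Longrightarrow> pairing (points_of G C) f y = 0"
      and v: "v \<in> points_of G C"
    have pins: "axis 1 1 \<bullet> y w = 0" "axis 2 1 \<bullet> y w = 0" "rot (p u - p w) \<bullet> y u = 0"
      using y(2)[OF \<Psi>(1)] y(2)[OF \<Psi>(2)] y(2)[OF \<Psi>(3)]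
      unfolding pairing_\<delta>[OF P(1)] pairing_\<delta>[OF P(2)] .
    from motion_rotation[OF y(1)] obtain s where
      s: "\<forall>i\<in>points G. \<forall>j\<in>points G. {i, j} \<in> C \<longrightarrow> y i - y j = s *\<^sub>R rot (p i - p j)"
      by (elim exE conjE)
    have yw: "y w = 0" using pins(1,2) by (simp add: inner_axis' vec2_eq_iff)
    have "y u = s *\<^sub>R rot (p u - p w)" using bspec[OF bspec[OF s uw(2)] uw(3)] uwC yw by simp
    then have "s = 0" using pins(3) puw(2) by simp
    then have "y i = y j" if "{i, j} \<in> C" "i \<in> points G" "j \<in> points G" for i j
      using bspec[OF bspec[OF s that(2)] that(3)] that(1) by simp
    then have "y v = y w" by (rule constant_on_circuit[OF _ P(2) v])
    then show "y v = 0" using yw by simp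
  qed (simp add: \<Psi>_def)
  \<comment> \<open>An upper bound suffices, since fewer pins only strengthen the
    inequality.\<close>
  moreover have "card \<Psi> \<le> 3" unfolding \<Psi>_def
    using card_length[of "[\<delta> w (axis 1 1), \<delta> w (axis 2 1), \<delta> u (rot (p u - p w))]"] by simp
  ultimately show ?thesis by (simp add: nu_P_def)
qed

text \<open>Removing the trivial motions takes at most 3, 1 or 0 pins according to the normal
  dimension, and the redundant edge then puts \<open>card C\<close> at least one above the
  bound.\<close>

lemma generic_circuit_not_sparse:
  assumes incident: "\<And>e. e \<in> C \<Longrightarrow> e \<inter> points G \<noteq> {}"
  shows "\<not> int (card C) \<le> 2 * int (nu_P G C) - 3 + min 3 (2 * int (normal_dim G a C))"
proof (cases "lines_of G C = {}")
  case True
  then show ?thesis using card_circuit_ge_PP[OF True] normal_dim_eq_0[OF True] by simp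
next
  case False
  note perp = motion_orthogonal_normals[OF incident]
  from False show ?thesis
  proof (cases rule: normal_dim_cases)
    case (1 j)
    have "norm (a j) = 1" using 1 unit by (auto simp: lines_of_def)
    then have aj: "a j \<noteq> 0" by auto
    obtain e w where "e \<in> C" "w \<in> e" "w \<in> points G" using incident rel_nontrivial by blast
    then have w: "w \<in> points_of G C" unfolding points_of_def by blast
    \<comment> \<open>The velocity at \<open>w\<close> is already orthogonal to \<open>a j\<close>,
      so one pin in the other direction suffices.\<close>
    define f where "f = (\<lambda>x. if x = w then rot (a j) else 0)"
    have "2 * card (points_of G C) + 1 \<le> card C + card {f}"
    proof (rule card_circuit_ge)
      fix y v assume y: "motion y" "\<And>g. g \<in> {f} \<Longrightarrow> pairing (points_of G C) g y = 0"
        and v: "v \<in> points_of G C"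
      have "rot (a j) \<bullet> y w = 0"
        using y(2)[OF singletonI] unfolding f_def pairing_indicator[OF w] .
      then have "y w = 0" using orthogonal_both_eq_0[OF perp[OF _ y(1) w 1(1)]] aj by blast
      then show "y v = 0" using motion_constant_if_line[OF False y(1) v w] by simp
    qed simp
    then show ?thesis using 1(2) by (simp add: nu_P_def)
  next
    case 2
    have "2 * card (points_of G C) + 1 \<le> card C + card ({} :: ('a \<Rightarrow> real^2) set)"
    proof (rule card_circuit_ge)
      fix y v assume y: "motion y" and v: "v \<in> points_of G C"
      \<comment> \<open>Orthogonality to all normals extends to the whole plane, in particular to
        \<open>y v\<close> itself.\<close>
      have "orthogonal (y v) x" if "x \<in> span (a ` lines_of G C)" for x
        using that
      proof (rule orthogonal_to_span)
        fix z assume "z \<in> a ` lines_of G C"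
        then obtain j where "j \<in> lines_of G C" "z = a j" by blast
        then show "orthogonal (y v) z"
          using perp[OF _ y v, of j] by (simp add: orthogonal_def inner_commute)
      qed
      then show "y v = 0" using 2(2) orthogonal_self by blast
    qed simp
    then show ?thesis using 2(1) by (simp add: nu_P_def)
  qed
qed

end

section \<open>Sufficiency of the count\<close>

context pl_graph_normals
begin

text \<open>For a single line-line edge the right side of the count is at most 0.\<close>

lemma sparse_imp_point_incident:
  assumes sparse: "\<And>F. F \<subseteq> edges G \<Longrightarrow> F \<noteq> {} \<Longrightarrow>
      int (card F) \<le> 2 * int (nu_P G F) - 3 + min 3 (2 * int (normal_dim G a F))"
    and e: "e \<in> edges G"
  shows "e \<inter> points G \<noteq> {}"
proof
  assume "e \<inter> points G = {}"
  then have "points_of G {e} = {}" unfolding points_of_def by blast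
  then have "nu_P G {e} = 0" by (simp add: nu_P_def)
  then show False using sparse[of "{e}"] e by simp
qed

text \<open>A dependence at a generic placement contains an inclusion-minimal one, a circuit, and
  circuits violate the count.\<close>

lemma sparse_imp_exists_independent:
  assumes sparse: "\<And>F. F \<subseteq> edges G \<Longrightarrow> F \<noteq> {} \<Longrightarrow>
      int (card F) \<le> 2 * int (nu_P G F) - 3 + min 3 (2 * int (normal_dim G a F))"
  obtains p where "\<not> row_dependent (points G) (edge_row p) (edges G)"
proof -
  obtain p where p: "\<forall>F k. F \<subseteq> edges G \<longrightarrow> row_dependent (points G) (edge_row p) F \<longrightarrow>
    (\<forall>\<^sub>F n in sequentially. row_dependent (points G) (edge_row (perturb p k n)) F)"
    using exists_generic_placement by (elim exE)
  have "\<not> row_dependent (points G) (edge_row p) (edges G)"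
  proof
    assume dep: "row_dependent (points G) (edge_row p) (edges G)"
    define D where "D = {F. F \<subseteq> edges G \<and> row_dependent (points G) (edge_row p) F}"
    have "finite D" by (rule finite_subset[of _ "Pow (edges G)"]) (auto simp: D_def finite_edges)
    moreover have "edges G \<in> D" using dep by (simp add: D_def)
    ultimately obtain C where C: "C \<in> D" "\<And>F. F \<in> D \<Longrightarrow> F \<subseteq> C \<Longrightarrow> F = C"
      using finite_has_minimal[of D] by (metis empty_iff)
    then obtain c where c: "relation (points G) (edge_row p) C c" "\<exists>e\<in>C. c e \<noteq> 0"
      by (auto simp: D_def row_dependent_def)
    have CE: "C \<subseteq> edges G" using C(1) by (simp add: D_def)
    interpret generic_circuit G a p C c
    proof
      show "\<not> row_dependent (points G) (edge_row p) F" if "F \<subset> C" for F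
        using C(2)[of F] that CE by (auto simp: D_def)
    qed (use p CE c in auto)
    have "C \<noteq> {}" using c by blast
    then show False
      using generic_circuit_not_sparse sparse_imp_point_incident[OF sparse] sparse[OF CE] CE by blast
  qed
  then show ?thesis by (rule that)
qed

end

theorem theorem4p1:
  fixes G :: "'v pl_graph" and a :: "'v \<Rightarrow> real^2"
  assumes "point_line_graph G"
    and "\<forall>i \<in> lines G. a i \<in> sphere 0 1"
  shows "(\<exists>p l. point_line_framework G p l \<and> min_inf_fixed_line_rigid G p l \<and>
              (\<forall>i \<in> lines G. fst (l i) = a i))
     \<longleftrightarrow> card (edges G) = 2 * card (points G) \<and>
         (\<forall>F. F \<subseteq> edges G \<and> F \<noteq> {} \<longrightarrow>
            int (card F) \<le> 2 * int (nu_P G F) - 3 + min 3 (2 * int (normal_dim G a F)))"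
    (is "?L \<longleftrightarrow> ?R")
proof -
  interpret pl_graph_normals G a
    using assms by unfold_locales auto
  show ?thesis
  proof
    assume ?L
    then obtain p l where min: "min_inf_fixed_line_rigid G p l"
      and l: "\<And>j. j \<in> lines G \<Longrightarrow> fst (l j) = a j" by blast
    from min have card: "card (edges G) = 2 * card (points G)"
      and ind: "\<not> row_dependent (points G) (edge_row p) (edges G)"
      using min_rigid_iff[OF l, of p] by simp_all
    have "int (card F) \<le> 2 * int (nu_P G F) - 3 + min 3 (2 * int (normal_dim G a F))"
      if "F \<subseteq> edges G" "F \<noteq> {}" for F
      by (rule independent_imp_sparse[OF row_independent_subset[OF ind that(1) finite_edges] that])
    then show ?R using card by blast
  next
    assume R: ?R
    obtain p where p: "\<not> row_dependent (points G) (edge_row p) (edges G)"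
      by (rule sparse_imp_exists_independent) (use R in blast)
    \<comment> \<open>The default offset 0 puts every line through the origin.\<close>
    define l where "l j = (a j, 0::real)" for j
    have "min_inf_fixed_line_rigid G p l"
      using min_rigid_iff[of l p] R p by (simp add: l_def)
    moreover have "point_line_framework G p l"
      using assms by (simp add: point_line_framework_def l_def)
    ultimately show ?L by (intro exI[of _ p] exI[of _ l]) (simp add: l_def)
  qed
qed

end
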